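(* Let $m,n\geq 2$ be integers. If $\mathrm{ZT}(\mathbb{Z}_m)$ and $\mathrm{ZT}(\mathbb{Z}_n)$ are isomorphic graphs and are connected, then $m=n$.
   Context: $\mathbb{Z}_m$ is the ring of integers modulo $m$, and $Z(\mathbb{Z}_m)$ is its set of zero-divisors, with $0$ included. The total zero-divisor graph $\mathrm{ZT}(\mathbb{Z}_m)$ is the simple graph whose vertices are the nonzero zero-divisors of $\mathbb{Z}_m$, with distinct vertices $u,v$ adjacent if and only if $uv=0$ and $u+v\in Z(\mathbb{Z}_m)$. A graph is connected if it has at least one vertex and any two vertices are joined by a path (the graph with no vertices is not regarded as connected). *)

theory Defs
  imports "HOL-Number_Theory.Residues" "Graph_Theory.Graph_Theory"
begin

definition zero_divisors :: "('a, 'b) ring_scheme \<Rightarrow> 'a set" where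
  "zero_divisors R =
     {a \<in> carrier R. \<exists>b \<in> carrier R. b \<noteq> \<zero>\<^bsub>R\<^esub> \<and> a \<otimes>\<^bsub>R\<^esub> b = \<zero>\<^bsub>R\<^esub>}"

(* The simple graph is encoded as a loop-free symmetric digraph, each edge {u, v} being the
   two arcs (u, v) and (v, u); see ZT_symmetric and ZT_iso_iff. *)
definition ZT :: "('a, 'b) ring_scheme \<Rightarrow> 'a pair_pre_digraph" where
  "ZT R =
     \<lparr> pverts = zero_divisors R - {\<zero>\<^bsub>R\<^esub>},
       parcs = {(u, v). u \<in> zero_divisors R - {\<zero>\<^bsub>R\<^esub>} \<and> v \<in> zero_divisors R - {\<zero>\<^bsub>R\<^esub>} \<and>
                  u \<noteq> v \<and> u \<otimes>\<^bsub>R\<^esub> v = \<zero>\<^bsub>R\<^esub> \<and> u \<oplus>\<^bsub>R\<^esub> v \<in> zero_divisors R} \<rparr>"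

lemma ZT_wf: "pair_wf_digraph (ZT R)"
  by unfold_locales (auto simp: ZT_def)

lemma ZT_loopfree: "(u, u) \<notin> parcs (ZT R)"
  by (simp add: ZT_def)

lemma ZT_symmetric:
  assumes "cring R"
  shows "symmetric (ZT R)"
proof -
  interpret cring R by fact
  have "zero_divisors R \<subseteq> carrier R"
    by (auto simp: zero_divisors_def)
  then have "sym (parcs (ZT R))"
    by (auto simp: sym_def ZT_def m_comm a_comm subset_iff)
  moreover have "arcs_ends (with_proj (ZT R)) = parcs (ZT R)"
    by (auto simp: arcs_ends_def arc_to_ends_def)
  ultimately show ?thesis
    by (simp add: symmetric_def)
qed

lemma ZT_iso_iff:
  "digraph_iso (with_proj (ZT R)) (with_proj (ZT S)) \<longleftrightarrow>
     (\<exists>f. bij_betw f (pverts (ZT R)) (pverts (ZT S)) \<and>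
        (\<forall>u \<in> pverts (ZT R). \<forall>v \<in> pverts (ZT R).
           (u, v) \<in> parcs (ZT R) \<longleftrightarrow> (f u, f v) \<in> parcs (ZT S)))"
  (is "?L \<longleftrightarrow> ?R")
proof
  assume ?L
  then obtain h where h: "pre_digraph.digraph_isomorphism (with_proj (ZT R)) h"
    and eq: "with_proj (ZT S) = app_iso h (with_proj (ZT R))"
    by (auto simp: digraph_iso_def)
  define f where "f = iso_verts h"
  have V: "pverts (ZT S) = f ` pverts (ZT R)" and A: "parcs (ZT S) = iso_arcs h ` parcs (ZT R)"
    and t: "iso_tail h = fst" and hd: "iso_head h = snd"
    using eq by (auto simp: app_iso_def with_proj_def f_def)
  have inj: "inj_on f (pverts (ZT R))"
    and e: "\<And>a. a \<in> parcs (ZT R) \<Longrightarrow> iso_arcs h a = (f (fst a), f (snd a))"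
    using h t hd by (auto simp: pre_digraph.digraph_isomorphism_def f_def prod_eq_iff)
  have "(u, v) \<in> parcs (ZT R) \<longleftrightarrow> (f u, f v) \<in> parcs (ZT S)"
    if uv: "u \<in> pverts (ZT R)" "v \<in> pverts (ZT R)" for u v
  proof
    assume "(u, v) \<in> parcs (ZT R)"
    then show "(f u, f v) \<in> parcs (ZT S)" using e[of "(u, v)"] A by force
  next
    assume "(f u, f v) \<in> parcs (ZT S)"
    then obtain a where a: "a \<in> parcs (ZT R)" "iso_arcs h a = (f u, f v)" using A by auto
    have "fst a \<in> pverts (ZT R)" "snd a \<in> pverts (ZT R)"
      using a(1) by (auto simp: ZT_def)
    then have "a = (u, v)" using a e[OF a(1)] inj uv by (auto simp: prod_eq_iff dest: inj_onD)
    then show "(u, v) \<in> parcs (ZT R)" using a by simp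
  qed
  then show ?R using inj V by (auto simp: bij_betw_def)
next
  assume ?R
  then obtain f where b: "bij_betw f (pverts (ZT R)) (pverts (ZT S))"
    and e: "\<And>u v. u \<in> pverts (ZT R) \<Longrightarrow> v \<in> pverts (ZT R) \<Longrightarrow>
              (u, v) \<in> parcs (ZT R) \<longleftrightarrow> (f u, f v) \<in> parcs (ZT S)"
    by blast
  have VR: "u \<in> pverts (ZT R) \<and> v \<in> pverts (ZT R)" if "(u, v) \<in> parcs (ZT R)" for u v
    using that by (auto simp: ZT_def)
  have VS: "u \<in> pverts (ZT S) \<and> v \<in> pverts (ZT S)" if "(u, v) \<in> parcs (ZT S)" for u v
    using that by (auto simp: ZT_def)
  have inj: "inj_on f (pverts (ZT R))" and V: "f ` pverts (ZT R) = pverts (ZT S)"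
    using b by (auto simp: bij_betw_def)
  define h where "h = \<lparr> iso_verts = f, iso_arcs = map_prod f f, iso_head = snd, iso_tail = fst \<rparr>"
  have "wf_digraph (with_proj (ZT R))"
    using VR by unfold_locales auto
  moreover have "inj_on (map_prod f f) (parcs (ZT R))"
  proof (rule inj_onI)
    fix a b
    assume "a \<in> parcs (ZT R)" "b \<in> parcs (ZT R)" "map_prod f f a = map_prod f f b"
    then show "a = b"
      using VR inj by (cases a; cases b) (auto dest: inj_onD)
  qed
  ultimately have iso: "pre_digraph.digraph_isomorphism (with_proj (ZT R)) h"
    using inj by (auto simp: pre_digraph.digraph_isomorphism_def h_def)
  have "parcs (ZT S) = map_prod f f ` parcs (ZT R)"
  proof (intro equalityI subrelI)
    fix x y assume xy: "(x, y) \<in> parcs (ZT S)"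
    then obtain u v where "u \<in> pverts (ZT R)" "v \<in> pverts (ZT R)" "x = f u" "y = f v"
      using VS[OF xy] V by blast
    then show "(x, y) \<in> map_prod f f ` parcs (ZT R)" using e xy by force
  next
    fix x y assume "(x, y) \<in> map_prod f f ` parcs (ZT R)"
    then show "(x, y) \<in> parcs (ZT S)" using e VR by auto
  qed
  then have "with_proj (ZT S) = app_iso h (with_proj (ZT R))"
    using V by (simp add: app_iso_def h_def with_proj_def)
  with iso show ?L by (auto simp: digraph_iso_def)
qed

end

theory Submission
  imports Defs
begin

text \<open>
  The two numbers \<open>p\<close> and \<open>m div p\<close>, where \<open>p\<close> is the least prime factor of \<open>m\<close>, can be read off
  from the vertices of maximum degree, and \<open>m\<close> is their product.

  Connectedness enters only through \<open>p\<^sup>2 dvd m\<close>: if \<open>m\<close> is prime, the graph is empty, and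
  otherwise a prime dividing \<open>m\<close> exactly once is an isolated vertex beside another one
  (\<open>connected_imp_prime_square_dvd\<close>).

  A vertex \<open>u\<close> with \<open>gcd u m = d\<close> is annihilated by exactly \<open>d - 1\<close> nonzero residues, the multiples
  of \<open>m div d\<close>, so its degree is at most \<open>d - 1\<close>. The largest possible \<open>d\<close> is \<open>m div p\<close>. If \<open>u\<close>
  attains it and \<open>p\<^sup>2 dvd m\<close>, then \<open>u\<close> and everything that annihilates it are multiples of \<open>p\<close>;
  hence all the sums are zero-divisors, and only \<open>u\<close> itself, whose square vanishes, has to be
  discounted. The degree is therefore \<open>m div p - 2\<close>. Every other vertex has \<open>d \<le> m div p - 2\<close>,
  because \<open>m div p - 1\<close> is not a divisor of \<open>m\<close> greater than 1 when \<open>p\<^sup>2 dvd m\<close>, and so has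
  strictly smaller degree.
  Thus the vertices of maximum degree are the \<open>p - 1\<close> nonzero multiples of \<open>m div p\<close>, and
  their degree is \<open>m div p - 2\<close> (\<open>max_degree_verts_ZT\<close>, \<open>card_max_degree_verts_ZT\<close>). An isomorphism
  preserves both the number of these vertices and their degree (\<open>iso_imp_max_degree_verts\<close>).
\<close>

section \<open>Total zero-divisor graphs of residue rings\<close>

lemma int_prime_divisor:
  fixes d :: int
  assumes "d > 1"
  obtains q where "prime q" "q dvd d"
proof -
  have "d \<noteq> 0" "\<not> is_unit d" using assms by (auto simp: zdvd1_eq)
  then obtain q where "q dvd d" "prime q" using prime_divisor_exists[of d] by blast
  then show thesis by (rule that[rotated])
qed

lemma int_not_coprime_prime:
  fixes a b :: int
  assumes "b > 0" "\<not> coprime a b"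
  obtains q where "prime q" "q dvd a" "q dvd b"
proof -
  have "gcd a b > 1"
    using assms gcd_pos_int[of a b] unfolding coprime_iff_gcd_eq_1 by linarith
  then obtain q where "prime q" "q dvd gcd a b" by (rule int_prime_divisor)
  then show thesis by (intro that[of q]) simp_all
qed

lemma zero_divisors_residue_ring:
  assumes "m \<ge> 2"
  shows "zero_divisors (residue_ring m) = {a \<in> {0..<m}. \<not> coprime a m}"
proof (intro equalityI subsetI)
  fix a assume "a \<in> zero_divisors (residue_ring m)"
  then obtain b where a: "0 \<le> a" "a < m" and b: "0 < b" "b < m" "m dvd a * b"
    by (force simp: zero_divisors_def residue_ring_def mod_eq_0_iff_dvd)
  have "\<not> coprime a m"
    using b by (metis coprime_commute coprime_dvd_mult_right_iff zdvd_not_zless)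
  with a show "a \<in> {a \<in> {0..<m}. \<not> coprime a m}" by simp
next
  fix a assume "a \<in> {a \<in> {0..<m}. \<not> coprime a m}"
  then have a: "0 \<le> a" "a < m" "\<not> coprime a m" by auto
  then obtain q where q: "prime q" "q dvd a" "q dvd m"
    using assms int_not_coprime_prime[of m a] by auto
  obtain c k where "a = q * c" "m = q * k" using q by (auto elim!: dvdE)
  moreover have "q > 1" using q prime_gt_1_int by auto
  moreover have "q * k > 0" using \<open>m = q * k\<close> assms by simp
  then have "k > 0" using \<open>q > 1\<close> by (simp add: zero_less_mult_iff)
  ultimately have "0 < k" "k < m" "m dvd a * k" by auto
  then have "\<exists>b \<in> {0..m - 1}. b \<noteq> 0 \<and> a * b mod m = 0"
    by (intro bexI[of _ k]) (simp_all add: mod_eq_0_iff_dvd)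
  with a show "a \<in> zero_divisors (residue_ring m)"
    by (simp add: zero_divisors_def residue_ring_def)
qed

lemma pverts_ZT_residue_ring:
  assumes "m \<ge> 2"
  shows "pverts (ZT (residue_ring m)) = {u \<in> {0<..<m}. \<not> coprime u m}"
proof -
  have "pverts (ZT (residue_ring m)) = zero_divisors (residue_ring m) - {0}"
    by (simp add: ZT_def residue_ring_def)
  then show ?thesis
    unfolding zero_divisors_residue_ring[OF assms] by (simp add: set_eq_iff less_le) blast
qed

lemma parcs_ZT_residue_ring:
  assumes "m \<ge> 2"
  shows "(u, v) \<in> parcs (ZT (residue_ring m)) \<longleftrightarrow>
    u \<in> pverts (ZT (residue_ring m)) \<and> v \<in> pverts (ZT (residue_ring m)) \<and>
    u \<noteq> v \<and> m dvd u * v \<and> \<not> coprime (u + v) m"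
proof -
  have "(u, v) \<in> parcs (ZT (residue_ring m)) \<longleftrightarrow>
    u \<in> pverts (ZT (residue_ring m)) \<and> v \<in> pverts (ZT (residue_ring m)) \<and>
    u \<noteq> v \<and> (u * v) mod m = 0 \<and> (u + v) mod m \<in> zero_divisors (residue_ring m)"
    by (auto simp: ZT_def residue_ring_def)
  then show ?thesis
    using assms by (simp add: zero_divisors_residue_ring mod_eq_0_iff_dvd)
qed

section \<open>Vertices of maximum degree\<close>

definition nbrs :: "'a pair_pre_digraph \<Rightarrow> 'a \<Rightarrow> 'a set" where
  "nbrs G u = {v \<in> pverts G. (u, v) \<in> parcs G}"

definition max_degree_verts :: "'a pair_pre_digraph \<Rightarrow> 'a set" where
  "max_degree_verts G = {u \<in> pverts G. \<forall>w \<in> pverts G. card (nbrs G w) \<le> card (nbrs G u)}"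

lemma iso_imp_max_degree_verts:
  assumes "digraph_iso (with_proj (ZT R)) (with_proj (ZT S))"
  obtains f where "bij_betw f (max_degree_verts (ZT R)) (max_degree_verts (ZT S))"
    "\<And>u. u \<in> max_degree_verts (ZT R) \<Longrightarrow> card (nbrs (ZT S) (f u)) = card (nbrs (ZT R) u)"
proof -
  obtain f where bij: "bij_betw f (pverts (ZT R)) (pverts (ZT S))"
    and adj: "\<forall>u \<in> pverts (ZT R). \<forall>v \<in> pverts (ZT R).
      (u, v) \<in> parcs (ZT R) \<longleftrightarrow> (f u, f v) \<in> parcs (ZT S)"
    using assms unfolding ZT_iso_iff by blast
  have V: "pverts (ZT S) = f ` pverts (ZT R)" and inj: "inj_on f (pverts (ZT R))"
    using bij by (auto simp: bij_betw_def)
  have deg: "card (nbrs (ZT S) (f u)) = card (nbrs (ZT R) u)" if "u \<in> pverts (ZT R)" for u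
  proof -
    have "nbrs (ZT S) (f u) = f ` nbrs (ZT R) u"
      using adj that by (auto simp: nbrs_def V)
    moreover have "inj_on f (nbrs (ZT R) u)"
      using inj by (rule inj_on_subset) (auto simp: nbrs_def)
    ultimately show ?thesis by (simp add: card_image)
  qed
  have "max_degree_verts (ZT S) = f ` max_degree_verts (ZT R)"
    by (auto simp: max_degree_verts_def V deg)
  moreover have "inj_on f (max_degree_verts (ZT R))"
    using inj by (rule inj_on_subset) (auto simp: max_degree_verts_def)
  ultimately show thesis
    using deg by (intro that[of f]) (auto simp: bij_betw_def max_degree_verts_def)
qed

section \<open>Counting annihilators\<close>

lemma card_multiples_below:
  fixes k m :: int
  assumes "m > 0" "k > 0" "k dvd m"
  shows "int (card {v \<in> {0<..<m}. k dvd v}) = m div k - 1"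
proof -
  obtain c where c: "m = k * c" using assms by blast
  have "{v \<in> {0<..<m}. k dvd v} = (\<lambda>j. k * j) ` {0<..<c}"
    using assms c by (auto simp: zero_less_mult_iff)
  moreover have "inj_on (\<lambda>j. k * j) {0<..<c}"
    using assms by (auto simp: inj_on_def)
  ultimately show ?thesis
    using assms c by (auto simp: card_image zero_less_mult_iff)
qed

lemma dvd_mult_iff_div_gcd_dvd:
  fixes m u v :: int
  assumes "m > 0"
  shows "m dvd u * v \<longleftrightarrow> m div gcd u m dvd v"
proof -
  define d where "d = gcd u m"
  have d: "d > 0" using assms by (simp add: d_def)
  obtain a b where ab: "u = a * d" "m = b * d" "coprime a b"
    using gcd_coprime_exists[of u m] d unfolding d_def by auto
  then have "m dvd u * v \<longleftrightarrow> b dvd a * v"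
    using d by (auto simp: mult.assoc mult.commute[of d] mult.left_commute[of d] simp flip: mult.assoc)
  also have "\<dots> \<longleftrightarrow> b dvd v"
    using ab(3) by (simp add: coprime_dvd_mult_right_iff coprime_commute)
  finally show ?thesis using ab d unfolding d_def[symmetric] by simp
qed

lemma card_annihilator:
  fixes m u :: int
  assumes "m > 0"
  shows "int (card {v \<in> {0<..<m}. m dvd u * v}) = gcd u m - 1"
proof -
  define d where "d = gcd u m"
  have "d > 0" "d dvd m" using assms by (simp_all add: d_def)
  then obtain k where k: "m = d * k" "k > 0"
    using assms by (metis dvdE zero_less_mult_pos)
  have "int (card {v \<in> {0<..<m}. k dvd v}) = d - 1"
    using card_multiples_below[of m k] assms k \<open>d > 0\<close> by simp
  moreover have "m div gcd u m = k"
    using k \<open>d > 0\<close> unfolding d_def[symmetric] by simp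
  ultimately show ?thesis
    using dvd_mult_iff_div_gcd_dvd[OF assms] by (simp add: d_def)
qed

section \<open>Least prime factors\<close>

definition least_prime_factor :: "int \<Rightarrow> int \<Rightarrow> bool" where
  "least_prime_factor p m \<longleftrightarrow> prime p \<and> p dvd m \<and> (\<forall>q. prime q \<longrightarrow> q dvd m \<longrightarrow> p \<le> q)"

lemma least_prime_factor_exists:
  assumes "m \<ge> 2"
  obtains p where "least_prime_factor p m"
proof -
  obtain q where "prime q" "q dvd m" using int_prime_divisor[of m] assms by auto
  then obtain p where p: "prime p \<and> p dvd m"
    and min: "\<And>r. prime r \<and> r dvd m \<Longrightarrow> nat p \<le> nat r"
    using ex_has_least_nat[of "\<lambda>r. prime r \<and> r dvd m" q nat] by blast
  have "p \<le> r" if "prime r" "r dvd m" for r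
    using min[of r] that prime_gt_0_int[of r] by linarith
  with p that show thesis by (auto simp: least_prime_factor_def)
qed

text \<open>The cofactor of a proper divisor has a prime factor, so it is at least \<open>p\<close>.\<close>
lemma proper_divisor_le:
  fixes d m :: int
  assumes "least_prime_factor p m" "m > 0" "d > 0" "d dvd m" "d < m"
  shows "d \<le> m div p"
proof -
  obtain e where e: "m = d * e" using assms by blast
  have "d * 1 < d * e" using e assms by simp
  then have "e > 1" using \<open>d > 0\<close> by (simp only: mult_less_cancel_left_pos)
  then obtain q where q: "prime q" "q dvd e" by (rule int_prime_divisor)
  then have "p \<le> q" using assms e by (auto simp: least_prime_factor_def)
  also have "q \<le> e" using q \<open>e > 1\<close> by (intro zdvd_imp_le) auto
  finally have "d * p \<le> m" using e assms by simp
  moreover have "p > 0" using assms prime_gt_0_int by (auto simp: least_prime_factor_def)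
  ultimately show ?thesis
    using zdiv_mono1[of "d * p" m p] by simp
qed

section \<open>Connectedness\<close>

text \<open>
  If \<open>m = p r\<close> with \<open>p\<close> not dividing \<open>r\<close>, then a neighbour \<open>v\<close> of \<open>p\<close> would be a multiple of \<open>r\<close>
  but not of \<open>p\<close>. Of the two summands of \<open>p + v\<close>, each prime factor of \<open>m\<close> would then divide
  exactly one, so the sum would be a unit. Hence \<open>p\<close> is isolated; if \<open>r > 1\<close>, it is separated
  from the vertex \<open>r\<close>, and if \<open>r = 1\<close>, the graph is empty.
\<close>
lemma connected_imp_prime_square_dvd:
  fixes m p :: int
  assumes "m \<ge> 2" "connected (with_proj (ZT (residue_ring m)))"
    and p: "prime p" "p dvd m"
  shows "p * p dvd m"
proof (rule ccontr)
  assume sq: "\<not> p * p dvd m"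
  let ?G = "ZT (residue_ring m)"
  have cring: "cring (residue_ring m)" using assms(1) by (intro residues.cring) (simp add: residues_def)
  interpret pair_wf_digraph ?G by (rule ZT_wf)
  obtain r where r: "m = p * r" using p by blast
  have p1: "p > 1" using p prime_gt_1_int by auto
  have pr: "\<not> p dvd r" using sq r by auto
  have "p * r > 0" using r assms(1) by simp
  then have r0: "r > 0" using p1 by (simp add: zero_less_mult_iff)
  have isolated: "(p, v) \<notin> parcs ?G" for v
  proof
    assume "(p, v) \<in> parcs ?G"
    then have v: "0 < v" "v < m" "m dvd p * v" "\<not> coprime (p + v) m"
      using assms(1) by (auto simp: parcs_ZT_residue_ring pverts_ZT_residue_ring)
    have rv: "r dvd v" using v(3) r p1 by simp
    have pv: "\<not> p dvd v"
    proof
      assume "p dvd v"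
      moreover have "coprime p r" using pr p by (simp add: prime_imp_coprime)
      ultimately have "m dvd v" using rv r by (simp add: divides_mult)
      then show False using v zdvd_not_zless by blast
    qed
    obtain q where q: "prime q" "q dvd p + v" "q dvd m"
      using v(4) assms(1) int_not_coprime_prime[of m "p + v"] by auto
    have "q \<noteq> p" using q(2) pv by auto
    then have "\<not> q dvd p" using q(1) p(1) primes_dvd_imp_eq by blast
    then have "q dvd r" using q r by (simp add: prime_dvd_mult_iff)
    then have "q dvd v" using rv dvd_trans by blast
    then have "q dvd p" using q(2) by (simp add: dvd_add_left_iff)
    with \<open>\<not> q dvd p\<close> show False by simp
  qed
  have sc: "strongly_connected (with_proj ?G)"
    by (rule symmetric_connected_imp_strongly_connected[OF ZT_symmetric[OF cring] assms(2)])
  then obtain u where "u \<in> pverts ?G" by (auto simp: strongly_connected_def)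
  then have u: "0 < u" "u < m" "\<not> coprime u m"
    using assms(1) by (auto simp: pverts_ZT_residue_ring)
  have "r \<noteq> 1"
  proof
    assume "r = 1"
    then have "p dvd u" using r u(3) p by (metis coprime_commute mult.right_neutral prime_imp_coprime)
    then show False using u \<open>r = 1\<close> r zdvd_not_zless by auto
  qed
  then have r1: "r > 1" using r0 by linarith
  have "p < m" "r < m" using r r1 p1 by auto
  moreover have "\<not> coprime p m" "\<not> coprime r m" using r p1 r1 by auto
  ultimately have "p \<in> pverts ?G" "r \<in> pverts ?G" using p1 r1 assms(1)
    by (auto simp: pverts_ZT_residue_ring)
  then have "p \<rightarrow>\<^sup>*\<^bsub>with_proj ?G\<^esub> r" using sc by (auto simp: strongly_connected_def)
  moreover have "p \<noteq> r" using pr by auto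
  ultimately obtain w where "p \<rightarrow>\<^bsub>with_proj ?G\<^esub> w"
    by (auto elim: pre_digraph.converse_reachable_cases)
  then show False using isolated by (auto simp: arcs_ends_def arc_to_ends_def)
qed

section \<open>Recovering the modulus\<close>

lemma card_nbrs_le:
  fixes m u :: int
  assumes "m \<ge> 2"
  shows "int (card (nbrs (ZT (residue_ring m)) u)) \<le> gcd u m - 1"
proof -
  have "nbrs (ZT (residue_ring m)) u \<subseteq> {v \<in> {0<..<m}. m dvd u * v}"
    using assms by (simp add: subset_iff nbrs_def parcs_ZT_residue_ring pverts_ZT_residue_ring)
  moreover have "finite {v \<in> {0<..<m}. m dvd u * v}"
    by (rule finite_subset[OF _ finite_greaterThanLessThan_int[of 0 m]]) blast
  ultimately have "card (nbrs (ZT (residue_ring m)) u) \<le> card {v \<in> {0<..<m}. m dvd u * v}"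
    by (intro card_mono)
  then show ?thesis using card_annihilator[of m u] assms by simp
qed

text \<open>
  The hypothesis \<open>p\<^sup>2 dvd m\<close> makes both \<open>u\<close> and all its annihilators multiples of \<open>p\<close>, so the
  condition on the sum excludes none of them. It also makes \<open>u\<close> one of its own annihilators,
  and the missing loop accounts for the difference from the bound \<open>gcd u m - 1\<close>.
\<close>
lemma card_nbrs_maximal:
  fixes m p u :: int
  assumes "m \<ge> 2" "prime p" "p * p dvd m" "gcd u m = m div p" "0 < u" "u < m"
  shows "int (card (nbrs (ZT (residue_ring m)) u)) = m div p - 2"
proof -
  obtain k where m: "m = p * p * k" using assms by blast
  have p1: "p > 1" using assms prime_gt_1_int by auto
  have "p * p * k > 0" using m assms(1) by simp
  then have k: "k > 0" using p1 by (simp add: zero_less_mult_iff)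
  have g: "gcd u m = p * k" using assms(4) m p1 by simp
  have pk: "p * k dvd u" using g by (metis gcd_dvd1)
  let ?A = "{v \<in> {0<..<m}. m dvd u * v}"
  have dvd: "p dvd v" if "m dvd u * v" for v
    using dvd_mult_iff_div_gcd_dvd[of m u v] that assms(1) g m p1 k by simp
  have pu: "p dvd u" using pk by (rule dvd_mult_left)
  have nc: "\<not> coprime x m" if "p dvd x" for x
    using that m p1 by (metis coprime_common_divisor dvd_mult_left dvd_triv_left not_prime_unit assms(2))
  have "nbrs (ZT (residue_ring m)) u = ?A - {u}"
  proof (intro equalityI subsetI)
    fix v assume "v \<in> nbrs (ZT (residue_ring m)) u"
    then show "v \<in> ?A - {u}"
      using assms(1) by (simp add: nbrs_def parcs_ZT_residue_ring pverts_ZT_residue_ring)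
  next
    fix v assume v: "v \<in> ?A - {u}"
    then have "p dvd v" using dvd by blast
    then have "\<not> coprime u m" "\<not> coprime v m" "\<not> coprime (u + v) m"
      using pu nc by (blast intro: dvd_add)+
    then show "v \<in> nbrs (ZT (residue_ring m)) u"
      using v assms(1,5,6)
      by (simp add: nbrs_def parcs_ZT_residue_ring pverts_ZT_residue_ring eq_commute[of u v])
  qed
  moreover have "m dvd u * u"
  proof -
    have "(p * k) * (p * k) dvd u * u" using pk by (simp add: mult_dvd_mono)
    then show ?thesis using m by (metis dvd_mult_left mult.assoc mult.left_commute)
  qed
  then have "u \<in> ?A" using assms by simp
  moreover have "finite ?A"
    by (rule finite_subset[OF _ finite_greaterThanLessThan_int[of 0 m]]) auto
  ultimately have "int (card (nbrs (ZT (residue_ring m)) u)) = int (card ?A) - 1"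
    by (metis card.remove of_nat_Suc add_diff_cancel_left')
  then show ?thesis using card_annihilator[of m u] assms by simp
qed

text \<open>
  The bound \<open>gcd u m - 1\<close> beats the degree \<open>m div p - 2\<close> only for \<open>gcd u m = m div p\<close>, and it ties
  for \<open>gcd u m = m div p - 1\<close>. The latter never happens for a vertex, which makes the maximum strict.
\<close>
lemma max_degree_verts_ZT:
  fixes m p :: int
  assumes m: "m \<ge> 2" and p: "least_prime_factor p m" and sq: "p * p dvd m"
  shows "max_degree_verts (ZT (residue_ring m)) = {u \<in> {0<..<m}. m div p dvd u}"
    and "\<And>u. u \<in> max_degree_verts (ZT (residue_ring m)) \<Longrightarrow>
      int (card (nbrs (ZT (residue_ring m)) u)) = m div p - 2"
proof -
  let ?G = "ZT (residue_ring m)" and ?h = "m div p"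
  let ?M = "{u \<in> {0<..<m}. ?h dvd u}"
  have prp: "prime p" using p by (simp add: least_prime_factor_def)
  then have p1: "p > 1" using prime_gt_1_int by auto
  obtain k where k: "m = p * (p * k)" using sq unfolding dvd_def by (auto simp: mult.assoc)
  have "p * (p * k) > 0" using k m by simp
  then have k0: "k > 0" using p1 by (simp add: zero_less_mult_iff)
  have h: "?h = p * k" using k p1 by simp
  then have mh: "m = p * ?h" using k by simp
  have "p * 1 \<le> p * k" using k0 p1 by (intro mult_left_mono) auto
  then have h1: "?h > 1" using h p1 by linarith
  have le: "gcd u m \<le> ?h" if "0 < u" "u < m" for u
  proof (rule proper_divisor_le[OF p])
    show "gcd u m < m" using that by (meson gcd_le1_int le_less_trans)
  qed (use m in auto)
  have gcd_M: "gcd u m = ?h" if "u \<in> ?M" for u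
  proof -
    have "?h dvd gcd u m"
      using that mh by (metis (no_types, lifting) dvd_triv_right gcd_greatest mem_Collect_eq)
    then have "?h \<le> gcd u m" using m by (intro zdvd_imp_le) auto
    with le[of u] that show ?thesis by auto
  qed
  have deg_M: "int (card (nbrs ?G u)) = ?h - 2" if "u \<in> ?M" for u
    using card_nbrs_maximal[OF m prp sq gcd_M[OF that]] that by simp
  have M_verts: "?M \<subseteq> pverts ?G"
  proof
    fix u assume u: "u \<in> ?M"
    then have "\<not> coprime u m" using gcd_M[OF u] h1 by (simp add: coprime_iff_gcd_eq_1)
    with u m show "u \<in> pverts ?G" by (simp add: pverts_ZT_residue_ring)
  qed
  have deg_less: "int (card (nbrs ?G u)) < ?h - 2" if u: "u \<in> pverts ?G" "u \<notin> ?M" for u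
  proof -
    define d where "d = gcd u m"
    have u': "0 < u" "u < m" "\<not> coprime u m" using u m by (auto simp: pverts_ZT_residue_ring)
    have "d > 0" using m by (simp add: d_def)
    moreover have "d \<noteq> 1" using u' by (simp add: d_def coprime_iff_gcd_eq_1)
    moreover have "d \<noteq> ?h"
      using u u' unfolding d_def
      by (metis (no_types, lifting) gcd_dvd1 greaterThanLessThan_iff mem_Collect_eq)
    moreover have "d \<noteq> ?h - 1"
    proof
      assume d: "d = ?h - 1"
      \<comment> \<open>From \<open>m = p (d + 1)\<close> the divisor \<open>d\<close> of \<open>m\<close> divides \<open>p\<close>, so \<open>d = p\<close>;
        but then \<open>p\<close> would divide the two consecutive integers \<open>d\<close> and \<open>m div p\<close>.\<close>
      have "p * k = d + 1" using h d by simp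
      then have "m = p * d + p" using k by (simp add: distrib_left)
      moreover have "d dvd m" by (simp add: d_def)
      ultimately have "d dvd p * d + p" by simp
      then have "d dvd p" by (simp add: dvd_add_right_iff)
      then have "d = p" using prp \<open>d > 0\<close> \<open>d \<noteq> 1\<close>
        unfolding prime_int_iff by (meson less_imp_le)
      then have "p * (k - 1) = 1" using d h by (simp add: algebra_simps)
      then have "p dvd 1" by (metis dvd_triv_left)
      then show False using p1 by (simp add: zdvd1_eq)
    qed
    ultimately have "d - 1 < ?h - 2" using le[of u] u' unfolding d_def by linarith
    with card_nbrs_le[OF m, of u] show ?thesis by (simp add: d_def)
  qed
  have "1 * ?h < p * ?h" using p1 h1 by (intro mult_strict_right_mono) auto
  then have "?h < m" using mh by linarith
  then have "?h \<in> ?M" using h1 by simp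
  show eq: "max_degree_verts ?G = ?M"
  proof (intro equalityI subsetI)
    fix u assume u: "u \<in> max_degree_verts ?G"
    then have "card (nbrs ?G ?h) \<le> card (nbrs ?G u)"
      using \<open>?h \<in> ?M\<close> M_verts unfolding max_degree_verts_def by blast
    then show "u \<in> ?M"
      using deg_less[of u] deg_M[OF \<open>?h \<in> ?M\<close>] u by (fastforce simp: max_degree_verts_def)
  next
    fix u assume u: "u \<in> ?M"
    have "card (nbrs ?G w) \<le> card (nbrs ?G u)" if "w \<in> pverts ?G" for w
      using deg_M[of w] deg_less[of w] deg_M[OF u] that by (cases "w \<in> ?M") linarith+
    then show "u \<in> max_degree_verts ?G" using u M_verts unfolding max_degree_verts_def by blast
  qed
  show "\<And>u. u \<in> max_degree_verts ?G \<Longrightarrow> int (card (nbrs ?G u)) = ?h - 2"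
    using deg_M eq by simp
qed

lemma card_max_degree_verts_ZT:
  fixes m p :: int
  assumes "m \<ge> 2" "least_prime_factor p m" "p * p dvd m"
  shows "int (card (max_degree_verts (ZT (residue_ring m)))) = p - 1"
proof -
  have p: "p > 1" using assms prime_gt_1_int by (auto simp: least_prime_factor_def)
  obtain r where r: "m = p * r" using assms by (auto simp: least_prime_factor_def)
  have "p * r > 0" using r assms(1) by simp
  then have "r > 0" using p by (simp add: zero_less_mult_iff)
  then show ?thesis
    using max_degree_verts_ZT(1)[OF assms] card_multiples_below[of m r] r p by simp
qed

theorem corollary4p3:
  fixes m n :: int
  assumes "m \<ge> 2" and "n \<ge> 2"
    and "digraph_iso (with_proj (ZT (residue_ring m))) (with_proj (ZT (residue_ring n)))"
    and "connected (with_proj (ZT (residue_ring m)))"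
    and "connected (with_proj (ZT (residue_ring n)))"
  shows "m = n"
proof -
  let ?G = "ZT (residue_ring m)" and ?H = "ZT (residue_ring n)"
  obtain p q where pq: "least_prime_factor p m" "least_prime_factor q n"
    using assms(1,2) least_prime_factor_exists by metis
  then have dvd: "prime p" "p dvd m" "prime q" "q dvd n" by (auto simp: least_prime_factor_def)
  then have sq: "p * p dvd m" "q * q dvd n"
    using connected_imp_prime_square_dvd assms by auto
  obtain f where f: "bij_betw f (max_degree_verts ?G) (max_degree_verts ?H)"
    and deg: "\<And>u. u \<in> max_degree_verts ?G \<Longrightarrow> card (nbrs ?H (f u)) = card (nbrs ?G u)"
    using iso_imp_max_degree_verts[OF assms(3)] by blast
  have "int (card (max_degree_verts ?G)) = int (card (max_degree_verts ?H))"
    using bij_betw_same_card[OF f] by simp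
  then have "p = q"
    using card_max_degree_verts_ZT pq sq assms(1,2) by simp
  have "int (card (max_degree_verts ?G)) > 0"
    using card_max_degree_verts_ZT[OF assms(1) pq(1) sq(1)] prime_gt_1_int[OF dvd(1)] by simp
  then obtain u where u: "u \<in> max_degree_verts ?G"
    by (metis card.empty equals0I less_irrefl of_nat_0)
  then have "f u \<in> max_degree_verts ?H" using f by (auto simp: bij_betw_def)
  then have "m div p = n div q"
    using max_degree_verts_ZT(2)[OF assms(1) pq(1) sq(1) u]
      max_degree_verts_ZT(2)[OF assms(2) pq(2) sq(2), of "f u"] deg[OF u] by linarith
  then show ?thesis
    using \<open>p = q\<close> dvd by (metis dvd_mult_div_cancel)
qed

end
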